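(* Let $R=\{(0,1),(1,1),(1,2),(2,0)\}$, and consider the two mesh patterns of length $2$ given by $P=(12,R)$ and $Q=(21,R)$. Then $P$ and $Q$ are equidistributed, i.e., for all $n\ge 0$, $$\sum_{\pi\in\mathcal{S}_n}y^{o_P(\pi)}=\sum_{\pi\in\mathcal{S}_n}y^{o_Q(\pi)}$$ as polynomials in $y$, where $o_p(\pi)$ denotes the number of occurrences of the mesh pattern $p$ in the permutation $\pi$.
   Context: $\mathcal{S}_n$ is the set of permutations of $\{1,\dots,n\}$, written in one-line notation $\pi=\pi_1\cdots\pi_n$. $[a,b]$ denotes the set of integers from $a$ to $b$. A mesh pattern of length $k$ is a pair $(\tau,R)$, where $\tau$ is a permutation of length $k$ and $R\subseteq[0,k]\times[0,k]$ is a set of shaded boxes. The pair $(i,j)$ denotes the box with corners $(i,j),(i,j+1),(i+1,j+1),(i+1,j)$, where the first coordinate is horizontal (position), the second is vertical (value), and the points of $\tau$ are drawn at $(m,\tau_m)$, $1\le m\le k$. A subsequence $\pi'$ of $\pi\in\mathcal{S}_n$ is an occurrence of $(\tau,R)$ if (1) $\pi'$ is an occurrence of $\tau$ in the classical sense (it has length $k$ and is order-isomorphic to $\tau$), and (2) the shaded boxes specified by $R$ contain no elements of $\pi$ other than those in $\pi'$. Explicitly, if $\pi'$ occupies positions $p_1<\dots<p_k$ and has values $v_1<\dots<v_k$ in increasing order, and one sets $p_0=v_0=0$ and $p_{k+1}=v_{k+1}=n+1$, then (2) says that for every $(i,j)\in R$ there is no position $q$ with $p_i<q<p_{i+1}$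 and $v_j<\pi_q<v_{j+1}$. $o_p(\pi)$ is the number of occurrences of $p$ in $\pi$. Two mesh patterns $p,q$ are equidistributed if $\sum_{\pi\in\mathcal{S}_n}y^{o_p(\pi)}=\sum_{\pi\in\mathcal{S}_n}y^{o_q(\pi)}$ for all $n\ge 0$. *)

theory Defs
  imports
    "HOL-Combinatorics.Permutations"
    "HOL-Computational_Algebra.Polynomial"
begin

text \<open>
  A permutation of length \<open>n\<close> is a function \<open>\<pi>\<close> with \<open>\<pi> permutes {1..n}\<close>; its one-line notation is
  \<open>\<pi> 1, \<dots>, \<pi> n\<close>. A mesh pattern is a triple \<open>(k, \<tau>, R)\<close> of its length, its underlying
  permutation and its set of shaded boxes.
\<close>

type_synonym mesh_pattern = "nat \<times> (nat \<Rightarrow> nat) \<times> (nat \<times> nat) set"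

fun is_mesh_pattern :: "mesh_pattern \<Rightarrow> bool" where
  "is_mesh_pattern (k, \<tau>, R) \<longleftrightarrow> \<tau> permutes {1..k} \<and> R \<subseteq> {0..k} \<times> {0..k}"

text \<open>
  For \<open>A = {a\<^sub>1 < \<dots> < a\<^sub>k} \<subseteq> {1..n}\<close> the list \<open>a\<^sub>0, a\<^sub>1, \<dots>, a\<^sub>k, a\<^sub>k\<^sub>+\<^sub>1\<close>, where \<open>a\<^sub>0 = 0\<close>
  and \<open>a\<^sub>k\<^sub>+\<^sub>1 = n + 1\<close>.
\<close>

definition grid_lines :: "nat \<Rightarrow> nat set \<Rightarrow> nat list" where
  "grid_lines n A = 0 # sorted_list_of_set A @ [n + 1]"

text \<open>
  A subsequence of \<open>\<pi>\<close> is given by the set \<open>S\<close> of the positions it occupies, so \<open>p ! i\<close> and \<open>v ! i\<close>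
  below are its \<open>i\<close>-th position and its \<open>i\<close>-th smallest value, counting from 1.
\<close>

fun is_occurrence :: "mesh_pattern \<Rightarrow> nat \<Rightarrow> (nat \<Rightarrow> nat) \<Rightarrow> nat set \<Rightarrow> bool" where
  "is_occurrence (k, \<tau>, R) n \<pi> S \<longleftrightarrow>
     S \<subseteq> {1..n} \<and> card S = k \<and>
     (let p = grid_lines n S; v = grid_lines n (\<pi> ` S) in
       (\<forall>a\<in>{1..k}. \<forall>b\<in>{1..k}. \<pi> (p ! a) < \<pi> (p ! b) \<longleftrightarrow> \<tau> a < \<tau> b) \<and>
       (\<forall>(i, j)\<in>R. \<not> (\<exists>q\<in>{1..n}. p ! i < q \<and> q < p ! (i + 1) \<and> v ! j < \<pi> q \<and> \<pi> q < v ! (j + 1))))"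

definition num_occurrences :: "mesh_pattern \<Rightarrow> nat \<Rightarrow> (nat \<Rightarrow> nat) \<Rightarrow> nat" where
  "num_occurrences P n \<pi> = card {S. is_occurrence P n \<pi> S}"

definition occurrence_poly :: "mesh_pattern \<Rightarrow> nat \<Rightarrow> int poly" where
  "occurrence_poly P n = (\<Sum>\<pi> | \<pi> permutes {1..n}. monom 1 (num_occurrences P n \<pi>))"

definition equidistributed :: "mesh_pattern \<Rightarrow> mesh_pattern \<Rightarrow> bool" where
  "equidistributed P Q \<longleftrightarrow> (\<forall>n. occurrence_poly P n = occurrence_poly Q n)"

definition shading :: "(nat \<times> nat) set" where
  "shading = {(0, 1), (1, 1), (1, 2), (2, 0)}"

definition pattern_12 :: mesh_pattern where
  "pattern_12 = (2, id, shading)"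

definition pattern_21 :: mesh_pattern where
  "pattern_21 = (2, Transposition.transpose 1 2, shading)"

lemma is_mesh_pattern_12: "is_mesh_pattern pattern_12"
  by (simp add: pattern_12_def shading_def permutes_id)

lemma is_mesh_pattern_21: "is_mesh_pattern pattern_21"
  by (simp add: pattern_21_def shading_def permutes_swap_id)

end

theory Submission
  imports Defs
begin

text \<open>
  Both patterns have the same shading, so exchanging the two entries of an occurrence of \<open>21\<close> turns it
  into an occurrence of \<open>12\<close> and conversely. An occurrence is determined by its smaller entry \<open>b\<close>. Fix
  a set \<open>B\<close> of values and a permutation in which every \<open>b \<in> B\<close> is the smaller entry of an occurrence
  of \<open>21\<close>. Exchanging these occurrences one after the other, in increasing order of \<open>b\<close>, preserves
  those already treated and those still to be treated, and the process can be reversed. Hence for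
  each \<open>B\<close> there are as many permutations in which all of \<open>B\<close> are smaller entries for \<open>21\<close> as for
  \<open>12\<close>, and \<open>y ^ |A| = (\<Sum>B\<subseteq>A. (y - 1) ^ |B|)\<close> converts this into equidistribution.
\<close>

section \<open>Occurrences indexed by their smaller entry\<close>

text \<open>The first clause merges the boxes (0,1) and (1,1); the second covers (1,1) and (1,2)
  together, since values are distinct; the third is box (2,0). The values at \<open>p\<close> and
  \<open>q\<close> themselves are never constrained.\<close>

definition box_free :: "nat \<Rightarrow> (nat \<Rightarrow> nat) \<Rightarrow> nat \<Rightarrow> nat \<Rightarrow> nat \<Rightarrow> nat \<Rightarrow> bool" where
  "box_free n \<pi> p q lo hi \<longleftrightarrow>
     (\<forall>r. 1 \<le> r \<longrightarrow> r < q \<longrightarrow> r \<noteq> p \<longrightarrow> \<pi> r \<le> lo \<or> hi \<le> \<pi> r) \<and>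
     (\<forall>r. p < r \<longrightarrow> r < q \<longrightarrow> \<pi> r < lo) \<and>
     (\<forall>r. q < r \<longrightarrow> r \<le> n \<longrightarrow> lo \<le> \<pi> r)"

text \<open>The index \<open>b\<close> is a value and not a position: exchanging the two entries
  keeps the smaller value but moves it.\<close>

definition asc_pair :: "nat \<Rightarrow> (nat \<Rightarrow> nat) \<Rightarrow> nat \<Rightarrow> nat \<Rightarrow> nat \<Rightarrow> bool" where
  "asc_pair n \<pi> b p q \<longleftrightarrow>
     1 \<le> p \<and> p < q \<and> q \<le> n \<and> \<pi> p = b \<and> b < \<pi> q \<and> box_free n \<pi> p q b (\<pi> q)"

definition desc_pair :: "nat \<Rightarrow> (nat \<Rightarrow> nat) \<Rightarrow> nat \<Rightarrow> nat \<Rightarrow> nat \<Rightarrow> bool" where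
  "desc_pair n \<pi> b p q \<longleftrightarrow>
     1 \<le> p \<and> p < q \<and> q \<le> n \<and> \<pi> q = b \<and> b < \<pi> p \<and> box_free n \<pi> p q b (\<pi> p)"

definition asc_bottoms :: "nat \<Rightarrow> (nat \<Rightarrow> nat) \<Rightarrow> nat set" where
  "asc_bottoms n \<pi> = {b. \<exists>p q. asc_pair n \<pi> b p q}"

definition desc_bottoms :: "nat \<Rightarrow> (nat \<Rightarrow> nat) \<Rightarrow> nat set" where
  "desc_bottoms n \<pi> = {b. \<exists>p q. desc_pair n \<pi> b p q}"

text \<open>The value \<open>b\<close> fixes \<open>p\<close>. All entries strictly between
  \<open>p\<close> and \<open>q\<close> are below \<open>b\<close>, so \<open>q\<close> is the first
  position after \<open>p\<close> with a value above \<open>b\<close>.\<close>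

lemma asc_pair_unique:
  assumes "inj \<pi>" "asc_pair n \<pi> b p q" "asc_pair n \<pi> b p' q'"
  shows "p = p' \<and> q = q'"
proof -
  have p: "p = p'"
    using assms by (metis asc_pair_def injD)
  have "\<not> q < q'" "\<not> q' < q"
    using assms p unfolding asc_pair_def box_free_def by (meson less_asym)+
  then show ?thesis using p by simp
qed

text \<open>Here \<open>b\<close> fixes \<open>q\<close>, and \<open>p\<close> is the last position
  before \<open>q\<close> with a value above \<open>b\<close>.\<close>

lemma desc_pair_unique:
  assumes "inj \<pi>" "desc_pair n \<pi> b p q" "desc_pair n \<pi> b p' q'"
  shows "p = p' \<and> q = q'"
proof -
  have q: "q = q'"
    using assms by (metis desc_pair_def injD)
  have "\<not> p < p'" "\<not> p' < p"
    using assms q unfolding desc_pair_def box_free_def by (meson less_asym)+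
  then show ?thesis using q by simp
qed

section \<open>Effect of one exchange on the exchanged pair and on the other pairs\<close>

abbreviation swap_at :: "(nat \<Rightarrow> nat) \<Rightarrow> nat \<Rightarrow> nat \<Rightarrow> nat \<Rightarrow> nat" where
  "swap_at \<pi> p q \<equiv> \<pi> \<circ> Transposition.transpose p q"

text \<open>\<open>box_free\<close> only restricts entries other than the two exchanged
  ones.\<close>

lemma asc_pair_swap_at: "desc_pair n \<pi> b p q \<Longrightarrow> asc_pair n (swap_at \<pi> p q) b p q"
  by (auto simp: asc_pair_def desc_pair_def box_free_def Transposition.transpose_def)

lemma desc_pair_swap_at: "asc_pair n \<pi> b p q \<Longrightarrow> desc_pair n (swap_at \<pi> p q) b p q"
  by (auto simp: asc_pair_def desc_pair_def box_free_def Transposition.transpose_def)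

lemma swap_at_swap_at: "swap_at (swap_at \<pi> p q) p q = \<pi>"
  by (simp add: comp_assoc)

text \<open>Both exchanged values exceed \<open>b\<close>, so neither stands strictly between
  \<open>r\<close> and \<open>s\<close>, and the entries below \<open>b\<close> do not move. Only
  the box between the two values needs care. If \<open>s = p\<close>, the larger entry drops to
  \<open>c\<close> and the box shrinks; \<open>s = q\<close> would make it grow and is
  excluded.\<close>

lemma asc_pair_swap_desc:
  assumes "desc_pair n \<pi> c p q" "asc_pair n \<pi> b r s" "b < c" "s \<noteq> q"
  shows "asc_pair n (swap_at \<pi> p q) b r s"
proof -
  have c: "1 \<le> p" "p < q" "q \<le> n" "\<pi> q = c" "c < \<pi> p"
    and c2: "\<And>x. p < x \<Longrightarrow> x < q \<Longrightarrow> \<pi> x < c"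
    using assms(1) by (auto simp: desc_pair_def box_free_def)
  have b: "1 \<le> r" "r < s" "s \<le> n" "\<pi> r = b" "b < \<pi> s"
    and b1: "\<And>x. 1 \<le> x \<Longrightarrow> x < s \<Longrightarrow> x \<noteq> r \<Longrightarrow> \<pi> x \<le> b \<or> \<pi> s \<le> \<pi> x"
    and b2: "\<And>x. r < x \<Longrightarrow> x < s \<Longrightarrow> \<pi> x < b"
    and b3: "\<And>x. s < x \<Longrightarrow> x \<le> n \<Longrightarrow> b \<le> \<pi> x"
    using assms(2) by (auto simp: asc_pair_def box_free_def)
  define \<tau> where "\<tau> = swap_at \<pi> p q"
  have sw: "\<tau> x = (if x = p then \<pi> q else if x = q then \<pi> p else \<pi> x)" for x
    by (simp add: \<tau>_def Transposition.transpose_def)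
  have r: "r \<noteq> p" "r \<noteq> q" using b c assms(3) by auto
  have "box_free n \<tau> r s b (\<tau> s)"
    unfolding box_free_def
  proof (intro conjI allI impI)
    fix x assume x: "1 \<le> x" "x < s" "x \<noteq> r"
    show "\<tau> x \<le> b \<or> \<tau> s \<le> \<tau> x"
      \<comment> \<open>For \<open>p < s < q\<close>, \<open>c2\<close> puts \<open>\<pi> s\<close>
        below \<open>c\<close>; for \<open>q < s\<close>, \<open>b1\<close> at \<open>q\<close>
        gives \<open>\<pi> s \<le> c\<close>. In both cases the two exchanged values stay above the
        box.\<close>
      using x b1[of x] b1[of q] c2[of s] b c r assms(3,4)
      by (cases s q rule: linorder_cases) (auto simp: sw)
  next
    fix x assume x: "r < x" "x < s"
    show "\<tau> x < b"
      using x b2[of x] b c r assms(3,4) by (auto simp: sw)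
  next
    fix x assume x: "s < x" "x \<le> n"
    show "b \<le> \<tau> x"
      using x b3[of x] b c r assms(3,4) by (auto simp: sw)
  qed
  then show ?thesis
    unfolding \<tau>_def[symmetric] using b c r assms(3,4) by (auto simp: asc_pair_def sw)
qed

text \<open>The critical case is \<open>s = p\<close>, where the larger entry rises from
  \<open>c\<close> to \<open>\<pi> q\<close>. The enlarged box remains empty because the pair for
  \<open>c\<close> already forbids values between \<open>c\<close> and \<open>\<pi> q\<close> to the
  left of \<open>p\<close>.\<close>

lemma asc_pair_swap_asc:
  assumes "asc_pair n \<pi> c p q" "asc_pair n \<pi> b r s" "b < c" "inj \<pi>"
  shows "asc_pair n (swap_at \<pi> p q) b r s"
proof -
  have c: "1 \<le> p" "p < q" "q \<le> n" "\<pi> p = c" "c < \<pi> q"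
    and c1: "\<And>x. 1 \<le> x \<Longrightarrow> x < q \<Longrightarrow> x \<noteq> p \<Longrightarrow> \<pi> x \<le> c \<or> \<pi> q \<le> \<pi> x"
    and c2: "\<And>x. p < x \<Longrightarrow> x < q \<Longrightarrow> \<pi> x < c"
    using assms(1) by (auto simp: asc_pair_def box_free_def)
  have b: "1 \<le> r" "r < s" "s \<le> n" "\<pi> r = b" "b < \<pi> s"
    and b1: "\<And>x. 1 \<le> x \<Longrightarrow> x < s \<Longrightarrow> x \<noteq> r \<Longrightarrow> \<pi> x \<le> b \<or> \<pi> s \<le> \<pi> x"
    and b2: "\<And>x. r < x \<Longrightarrow> x < s \<Longrightarrow> \<pi> x < b"
    and b3: "\<And>x. s < x \<Longrightarrow> x \<le> n \<Longrightarrow> b \<le> \<pi> x"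
    using assms(2) by (auto simp: asc_pair_def box_free_def)
  define \<tau> where "\<tau> = swap_at \<pi> p q"
  have sw: "\<tau> x = (if x = p then \<pi> q else if x = q then \<pi> p else \<pi> x)" for x
    by (simp add: \<tau>_def Transposition.transpose_def)
  have r: "r \<noteq> p" "r \<noteq> q" using b c assms(3) by auto
  \<comment> \<open>If \<open>s = q\<close>, then \<open>c\<close> at position \<open>p\<close>
    would lie in the box between \<open>b\<close> and \<open>\<pi> q\<close>.\<close>
  have s: "s \<noteq> q" using b1[of p] b c r assms(3) by auto
  have ne: "\<pi> x \<noteq> c" if "x \<noteq> p" for x using that c assms(4) by (metis injD)
  have "box_free n \<tau> r s b (\<tau> s)"
    unfolding box_free_def
  proof (intro conjI allI impI)
    fix x assume x: "1 \<le> x" "x < s" "x \<noteq> r"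
    show "\<tau> x \<le> b \<or> \<tau> s \<le> \<tau> x"
      using x b1[of x] b1[of p] b1[of q] c1[of x] c2[of s] ne[of x] b c r s assms(3)
      by (cases s q rule: linorder_cases) (auto simp: sw)
  next
    fix x assume x: "r < x" "x < s"
    show "\<tau> x < b"
      using x b2[of x] b c r s assms(3) b2[of p] b2[of q] by (auto simp: sw)
  next
    fix x assume x: "s < x" "x \<le> n"
    show "b \<le> \<tau> x"
      using x b3[of x] b c r s assms(3) by (auto simp: sw)
  qed
  then show ?thesis
    unfolding \<tau>_def[symmetric] using b c r s assms(3) by (auto simp: asc_pair_def sw)
qed

text \<open>The entry \<open>c\<close>, being smaller than \<open>b\<close>, cannot lie to the right
  of \<open>s\<close>; hence \<open>q < s\<close>, and the exchange only permutes entries to the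
  left of \<open>s\<close>. If both pairs share their larger entry, it moves from \<open>p\<close>
  to \<open>q\<close> and the pair for \<open>b\<close> follows it.\<close>

lemma desc_pair_swap_desc:
  assumes "desc_pair n \<pi> c p q" "desc_pair n \<pi> b r s" "c < b"
  shows "desc_pair n (swap_at \<pi> p q) b (if r = p then q else r) s"
proof -
  have c: "1 \<le> p" "p < q" "q \<le> n" "\<pi> q = c" "c < \<pi> p"
    and c2: "\<And>x. p < x \<Longrightarrow> x < q \<Longrightarrow> \<pi> x < c"
    using assms(1) by (auto simp: desc_pair_def box_free_def)
  have b: "1 \<le> r" "r < s" "s \<le> n" "\<pi> s = b" "b < \<pi> r"
    and b1: "\<And>x. 1 \<le> x \<Longrightarrow> x < s \<Longrightarrow> x \<noteq> r \<Longrightarrow> \<pi> x \<le> b \<or> \<pi> r \<le> \<pi> x"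
    and b2: "\<And>x. r < x \<Longrightarrow> x < s \<Longrightarrow> \<pi> x < b"
    and b3: "\<And>x. s < x \<Longrightarrow> x \<le> n \<Longrightarrow> b \<le> \<pi> x"
    using assms(2) by (auto simp: desc_pair_def box_free_def)
  define \<tau> where "\<tau> = swap_at \<pi> p q"
  have sw: "\<tau> x = (if x = p then \<pi> q else if x = q then \<pi> p else \<pi> x)" for x
    by (simp add: \<tau>_def Transposition.transpose_def)
  define t where "t = (if r = p then q else r)"
  have "\<not> s < q" using b3[of q] c assms(3) by auto
  moreover from this have "s \<noteq> p" "s \<noteq> q" using b c assms(3) by auto
  ultimately have s: "q < s" using c c2[of s] b assms(3) by force
  have r: "r \<noteq> q" using b c assms(3) by auto
  have r': "r \<le> p \<or> q \<le> r" using b c c2[of r] assms(3) by force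
  have t: "\<tau> t = \<pi> r" "1 \<le> t" "t < s"
    using r b c s by (auto simp: t_def sw)
  have "box_free n \<tau> t s b (\<tau> t)"
    unfolding box_free_def
  proof (intro conjI allI impI)
    fix x assume x: "1 \<le> x" "x < s" "x \<noteq> t"
    show "\<tau> x \<le> b \<or> \<tau> t \<le> \<tau> x"
      using x b1[of x] b1[of p] b1[of q] b c r r' s t assms(3) unfolding t
      by (auto simp: sw t_def split: if_splits)
  next
    fix x assume x: "t < x" "x < s"
    show "\<tau> x < b"
      using x b2[of x] b2[of p] b2[of q] c2[of x] b c r r' s assms(3)
      by (auto simp: sw t_def split: if_splits)
  next
    fix x assume x: "s < x" "x \<le> n"
    show "b \<le> \<tau> x"
      using x b3[of x] b c r s assms(3) by (auto simp: sw)
  qed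
  then show ?thesis
    unfolding t_def[symmetric] \<tau>_def[symmetric] using b c s t by (auto simp: desc_pair_def sw)
qed

text \<open>The assumption \<open>b \<noteq> \<pi> q\<close> keeps \<open>b\<close> in place and
  yields \<open>q < s\<close>. A shared larger entry now moves left from \<open>q\<close> to
  \<open>p\<close>; this is harmless, since \<open>c\<close> and the entries strictly between
  \<open>p\<close> and \<open>q\<close> are all below \<open>b\<close>.\<close>

lemma desc_pair_swap_asc:
  assumes "asc_pair n \<pi> c p q" "desc_pair n \<pi> b r s" "c < b" "b \<noteq> \<pi> q"
  shows "desc_pair n (swap_at \<pi> p q) b (if r = q then p else r) s"
proof -
  have c: "1 \<le> p" "p < q" "q \<le> n" "\<pi> p = c" "c < \<pi> q"
    and c2: "\<And>x. p < x \<Longrightarrow> x < q \<Longrightarrow> \<pi> x < c"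
    using assms(1) by (auto simp: asc_pair_def box_free_def)
  have b: "1 \<le> r" "r < s" "s \<le> n" "\<pi> s = b" "b < \<pi> r"
    and b1: "\<And>x. 1 \<le> x \<Longrightarrow> x < s \<Longrightarrow> x \<noteq> r \<Longrightarrow> \<pi> x \<le> b \<or> \<pi> r \<le> \<pi> x"
    and b2: "\<And>x. r < x \<Longrightarrow> x < s \<Longrightarrow> \<pi> x < b"
    and b3: "\<And>x. s < x \<Longrightarrow> x \<le> n \<Longrightarrow> b \<le> \<pi> x"
    using assms(2) by (auto simp: desc_pair_def box_free_def)
  define \<tau> where "\<tau> = swap_at \<pi> p q"
  have sw: "\<tau> x = (if x = p then \<pi> q else if x = q then \<pi> p else \<pi> x)" for x
    by (simp add: \<tau>_def Transposition.transpose_def)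
  define t where "t = (if r = q then p else r)"
  have "\<not> s < p" using b3[of p] c assms(3) by auto
  moreover from this have "s \<noteq> p" "s \<noteq> q" using b c assms(3,4) by auto
  ultimately have s: "q < s" using c c2[of s] b assms(3) by force
  have r: "r \<noteq> p" using b c assms(3) by auto
  have r': "r \<le> p \<or> q \<le> r" using b c c2[of r] assms(3) by force
  have t: "\<tau> t = \<pi> r" "1 \<le> t" "t < s"
    using r b c s by (auto simp: t_def sw)
  have "box_free n \<tau> t s b (\<tau> t)"
    unfolding box_free_def
  proof (intro conjI allI impI)
    fix x assume x: "1 \<le> x" "x < s" "x \<noteq> t"
    show "\<tau> x \<le> b \<or> \<tau> t \<le> \<tau> x"
      using x b1[of x] b1[of p] b1[of q] b c r r' s t assms(3) unfolding t
      by (auto simp: sw t_def split: if_splits)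
  next
    fix x assume x: "t < x" "x < s"
    show "\<tau> x < b"
      using x b2[of x] b2[of p] b2[of q] c2[of x] b c r r' s assms(3)
      by (cases x q rule: linorder_cases) (auto simp: sw t_def split: if_splits)
  next
    fix x assume x: "s < x" "x \<le> n"
    show "b \<le> \<tau> x"
      using x b3[of x] b c r s assms(3) by (auto simp: sw)
  qed
  then show ?thesis
    unfolding t_def[symmetric] \<tau>_def[symmetric] using b c s t by (auto simp: desc_pair_def sw)
qed

section \<open>Stages of the exchange for a fixed set of smaller entries\<close>

text \<open>
  An intermediate stage of the exchange. The condition on \<open>\<pi> q\<close> is what makes the stages match: in
  \<open>312\<close> with \<open>B = {1, 2}\<close> and \<open>c = 2\<close> the pair \<open>(1, 2)\<close> is an occurrence of \<open>12\<close> and \<open>(3, 2)\<close> one of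
  \<open>21\<close>, but exchanging the latter destroys the former.
\<close>

definition mixed :: "nat \<Rightarrow> nat set \<Rightarrow> nat \<Rightarrow> (nat \<Rightarrow> nat) set" where
  "mixed n B c = {\<pi>. \<pi> permutes {1..n} \<and>
     (\<forall>b\<in>B. b < c \<longrightarrow> (\<exists>p q. asc_pair n \<pi> b p q \<and> (\<pi> q \<in> B \<longrightarrow> \<pi> q < c))) \<and>
     (\<forall>b\<in>B. c \<le> b \<longrightarrow> b \<in> desc_bottoms n \<pi>)}"

lemma finite_mixed: "finite (mixed n B c)"
  by (rule finite_subset[OF _ finite_permutations[of "{1..n}"]]) (auto simp: mixed_def)

lemma swap_at_permutes:
  assumes "\<pi> permutes {1..n}" "1 \<le> p" "p < q" "q \<le> n"
  shows "swap_at \<pi> p q permutes {1..n}"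
  using assms by (intro permutes_compose permutes_swap_id) auto

text \<open>The condition on larger entries serves twice: it guarantees \<open>s \<noteq> q\<close>
  for the pairs already treated, and it has to be re-established for the new pair.\<close>

lemma swap_desc_mixed:
  assumes "\<pi> \<in> mixed n B c" "c \<in> B" "desc_pair n \<pi> c p q"
  shows "swap_at \<pi> p q \<in> mixed n B (Suc c)"
proof -
  have perm: "\<pi> permutes {1..n}" using assms(1) by (simp add: mixed_def)
  have c: "1 \<le> p" "p < q" "q \<le> n" "\<pi> q = c" "c < \<pi> p"
    using assms(3) by (auto simp: desc_pair_def)
  have sw: "swap_at \<pi> p q x = (if x = p then \<pi> q else if x = q then \<pi> p else \<pi> x)" for x
    by (simp add: Transposition.transpose_def)
  \<comment> \<open>If \<open>\<pi> p\<close> were in \<open>B\<close>, it would be the smaller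
    entry of a descending pair ending at \<open>p\<close>, but \<open>c\<close> at \<open>q\<close>
    lies to its right and is smaller, violating box (2,0).\<close>
  have top: "\<pi> p \<notin> B"
  proof
    assume "\<pi> p \<in> B"
    then obtain r s where "desc_pair n \<pi> (\<pi> p) r s"
      using assms(1) c by (fastforce simp: mixed_def desc_bottoms_def)
    then show False
      using c permutes_inj[OF perm] unfolding desc_pair_def box_free_def
      by (metis injD leD)
  qed
  have "\<exists>r s. asc_pair n (swap_at \<pi> p q) b r s \<and>
      (swap_at \<pi> p q s \<in> B \<longrightarrow> swap_at \<pi> p q s < Suc c)" if b: "b \<in> B" "b < Suc c" for b
  proof (cases "b = c")
    case True
    then show ?thesis
      using asc_pair_swap_at[OF assms(3)] top c by (metis sw less_imp_neq)
  next
    case False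
    then obtain r s where rs: "asc_pair n \<pi> b r s" "\<pi> s \<in> B \<longrightarrow> \<pi> s < c"
      using b assms(1) unfolding mixed_def by force
    \<comment> \<open>Otherwise \<open>\<pi> s = c\<close> would be a larger entry in
      \<open>B\<close> that is not below \<open>c\<close>.\<close>
    then have "s \<noteq> q" using assms(2) c by auto
    then have "asc_pair n (swap_at \<pi> p q) b r s"
      using asc_pair_swap_desc assms(3) rs(1) b False by simp
    moreover have "swap_at \<pi> p q s \<in> B \<longrightarrow> swap_at \<pi> p q s < Suc c"
      using rs(2) \<open>s \<noteq> q\<close> c unfolding sw by auto
    ultimately show ?thesis by blast
  qed
  moreover have "b \<in> desc_bottoms n (swap_at \<pi> p q)" if b: "b \<in> B" "Suc c \<le> b" for b
  proof -
    obtain r s where "desc_pair n \<pi> b r s"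
      using b assms(1) unfolding mixed_def desc_bottoms_def by force
    then show ?thesis
      using desc_pair_swap_desc[OF assms(3)] b unfolding desc_bottoms_def by fastforce
  qed
  ultimately show ?thesis
    using swap_at_permutes[OF perm c(1-3)] unfolding mixed_def by blast
qed

text \<open>The reverse step: the condition on larger entries keeps \<open>\<pi> q\<close> out of
  \<open>B\<close>, so that moving it disturbs no descending pair still required.\<close>

lemma swap_asc_mixed:
  assumes "\<pi> \<in> mixed n B (Suc c)" "c \<in> B" "asc_pair n \<pi> c p q"
  shows "swap_at \<pi> p q \<in> mixed n B c"
proof -
  have perm: "\<pi> permutes {1..n}" using assms(1) by (simp add: mixed_def)
  have c: "1 \<le> p" "p < q" "q \<le> n" "\<pi> p = c" "c < \<pi> q"
    using assms(3) by (auto simp: asc_pair_def)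
  have sw: "swap_at \<pi> p q x = (if x = p then \<pi> q else if x = q then \<pi> p else \<pi> x)" for x
    by (simp add: Transposition.transpose_def)
  obtain p' q' where "asc_pair n \<pi> c p' q'" "\<pi> q' \<in> B \<longrightarrow> \<pi> q' < Suc c"
    using assms(1,2) unfolding mixed_def by blast
  \<comment> \<open>By uniqueness the pair supplied by \<open>mixed\<close> is
    \<open>(p, q)\<close>, and \<open>\<pi> q > c\<close> rules out
    \<open>\<pi> q < Suc c\<close>.\<close>
  then have top: "\<pi> q \<notin> B"
    using asc_pair_unique[OF permutes_inj[OF perm] assms(3)] c by force
  have "\<exists>r s. asc_pair n (swap_at \<pi> p q) b r s \<and>
      (swap_at \<pi> p q s \<in> B \<longrightarrow> swap_at \<pi> p q s < c)" if b: "b \<in> B" "b < c" for b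
  proof -
    obtain r s where rs: "asc_pair n \<pi> b r s" "\<pi> s \<in> B \<longrightarrow> \<pi> s < Suc c"
      using b assms(1) unfolding mixed_def by force
    have new: "asc_pair n (swap_at \<pi> p q) b r s"
      using asc_pair_swap_asc[OF assms(3) rs(1) b(2) permutes_inj[OF perm]] .
    have "s \<noteq> q"
      using rs(1) c b unfolding asc_pair_def box_free_def by (metis leD nat_neq_iff less_imp_le)
    \<comment> \<open>This sharpens the bound from \<open>Suc c\<close> to \<open>c\<close>; for
      \<open>s = p\<close> the new larger entry is \<open>\<pi> q\<close>, which is outside
      \<open>B\<close>.\<close>
    moreover have "\<pi> s \<noteq> c" if "s \<noteq> p" using that c permutes_inj[OF perm] by (metis injD)
    ultimately have "swap_at \<pi> p q s \<in> B \<longrightarrow> swap_at \<pi> p q s < c"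
      using rs(2) top unfolding sw by auto
    then show ?thesis using new by blast
  qed
  moreover have "b \<in> desc_bottoms n (swap_at \<pi> p q)" if b: "b \<in> B" "c \<le> b" for b
  proof (cases "b = c")
    case True
    then show ?thesis using desc_pair_swap_at[OF assms(3)] unfolding desc_bottoms_def by blast
  next
    case False
    then obtain r s where "desc_pair n \<pi> b r s"
      using b assms(1) unfolding mixed_def desc_bottoms_def by force
    then show ?thesis
      using desc_pair_swap_asc[OF assms(3)] b False top unfolding desc_bottoms_def by fastforce
  qed
  ultimately show ?thesis
    using swap_at_permutes[OF perm c(1-3)] unfolding mixed_def by blast
qed

lemma inj_mixed: "\<pi> \<in> mixed n B c \<Longrightarrow> inj \<pi>"
  by (auto simp: mixed_def intro: permutes_inj)

text \<open>For \<open>c \<in> B\<close> the exchange at \<open>c\<close> gives an injection in each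
  direction: the pair for \<open>c\<close> in the image is unique, and exchanging it again recovers
  the original permutation.\<close>

lemma card_mixed_Suc: "card (mixed n B c) = card (mixed n B (Suc c))"
proof (cases "c \<in> B")
  case False
  \<comment> \<open>This is applied to larger entries in \<open>B\<close> as well as to smaller
    ones.\<close>
  then have "b < Suc c \<longleftrightarrow> b < c" "Suc c \<le> b \<longleftrightarrow> c \<le> b" if "b \<in> B" for b
    using that by (cases "b = c"; auto)+
  then have "mixed n B c = mixed n B (Suc c)"
    by (simp add: mixed_def cong: imp_cong conj_cong)
  then show ?thesis by simp
next
  case True
  have "\<forall>\<pi>\<in>mixed n B c. \<exists>\<rho>. \<rho> \<in> mixed n B (Suc c) \<and>
      (\<exists>p q. asc_pair n \<rho> c p q \<and> \<pi> = swap_at \<rho> p q)"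
  proof
    fix \<pi> assume \<pi>: "\<pi> \<in> mixed n B c"
    then obtain p q where "desc_pair n \<pi> c p q"
      using True by (auto simp: mixed_def desc_bottoms_def)
    then show "\<exists>\<rho>. \<rho> \<in> mixed n B (Suc c) \<and> (\<exists>p q. asc_pair n \<rho> c p q \<and> \<pi> = swap_at \<rho> p q)"
      using swap_desc_mixed[OF \<pi> True] asc_pair_swap_at swap_at_swap_at by metis
  qed
  then obtain f where f: "\<forall>\<pi>\<in>mixed n B c. f \<pi> \<in> mixed n B (Suc c) \<and>
      (\<exists>p q. asc_pair n (f \<pi>) c p q \<and> \<pi> = swap_at (f \<pi>) p q)"
    by (rule bchoice[THEN exE])
  have "inj_on f (mixed n B c)"
    using f inj_mixed asc_pair_unique by (intro inj_onI) metis
  then have le: "card (mixed n B c) \<le> card (mixed n B (Suc c))"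
    using f finite_mixed by (intro card_inj_on_le[of f]) auto
  have "\<forall>\<pi>\<in>mixed n B (Suc c). \<exists>\<rho>. \<rho> \<in> mixed n B c \<and>
      (\<exists>p q. desc_pair n \<rho> c p q \<and> \<pi> = swap_at \<rho> p q)"
  proof
    fix \<pi> assume \<pi>: "\<pi> \<in> mixed n B (Suc c)"
    then obtain p q where "asc_pair n \<pi> c p q"
      using True unfolding mixed_def by blast
    then show "\<exists>\<rho>. \<rho> \<in> mixed n B c \<and> (\<exists>p q. desc_pair n \<rho> c p q \<and> \<pi> = swap_at \<rho> p q)"
      using swap_asc_mixed[OF \<pi> True] desc_pair_swap_at swap_at_swap_at by metis
  qed
  then obtain g where g: "\<forall>\<pi>\<in>mixed n B (Suc c). g \<pi> \<in> mixed n B c \<and>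
      (\<exists>p q. desc_pair n (g \<pi>) c p q \<and> \<pi> = swap_at (g \<pi>) p q)"
    by (rule bchoice[THEN exE])
  have "inj_on g (mixed n B (Suc c))"
    using g inj_mixed desc_pair_unique by (intro inj_onI) metis
  then have "card (mixed n B (Suc c)) \<le> card (mixed n B c)"
    using g finite_mixed by (intro card_inj_on_le[of g]) auto
  with le show ?thesis by simp
qed

lemma card_asc_bottoms_superset:
  assumes "B \<subseteq> {1..n}"
  shows "card {\<pi>. \<pi> permutes {1..n} \<and> B \<subseteq> asc_bottoms n \<pi>} =
    card {\<pi>. \<pi> permutes {1..n} \<and> B \<subseteq> desc_bottoms n \<pi>}"
proof -
  have "card (mixed n B c) = card (mixed n B 0)" for c
    by (induction c) (simp_all add: card_mixed_Suc[symmetric])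
  moreover have "mixed n B 0 = {\<pi>. \<pi> permutes {1..n} \<and> B \<subseteq> desc_bottoms n \<pi>}"
    by (auto simp: mixed_def)
  \<comment> \<open>At the last stage every element of \<open>B\<close> is below
    \<open>Suc n\<close>, so the condition on larger entries holds automatically.\<close>
  moreover have "mixed n B (Suc n) = {\<pi>. \<pi> permutes {1..n} \<and> B \<subseteq> asc_bottoms n \<pi>}"
  proof -
    have le: "b < Suc n" if "b \<in> B" for b using that assms by auto
    then have "\<not> Suc n \<le> b" if "b \<in> B" for b using that by (meson leD)
    with le show ?thesis unfolding mixed_def asc_bottoms_def by blast
  qed
  ultimately show ?thesis by metis
qed

section \<open>Generating functions from superset counts\<close>

lemma power_card_eq_sum_subsets:
  fixes x :: "'a :: comm_ring_1"
  assumes "finite A"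
  shows "x ^ card A = (\<Sum>B\<in>Pow A. (x - 1) ^ card B)"
proof -
  have "(\<Prod>a\<in>A. (x - 1) + 1) = (\<Sum>B\<in>Pow A. (\<Prod>a\<in>B. x - 1) * (\<Prod>a\<in>A-B. 1))"
    by (rule prod_add[OF assms])
  then show ?thesis by simp
qed

text \<open>Expanding \<open>x = (x - 1) + 1\<close> over each \<open>S m\<close> and interchanging
  the sums shows that the distribution of \<open>card (S m)\<close> depends only on how many
  \<open>S m\<close> contain each \<open>B\<close>.\<close>

lemma sum_power_card_eq_subsets:
  fixes x :: "'a :: comm_ring_1"
  assumes "finite M" "finite U" "\<And>m. m \<in> M \<Longrightarrow> S m \<subseteq> U"
  shows "(\<Sum>m\<in>M. x ^ card (S m)) = (\<Sum>B\<in>Pow U. of_nat (card {m\<in>M. B \<subseteq> S m}) * (x - 1) ^ card B)"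
proof -
  have "(\<Sum>m\<in>M. x ^ card (S m)) = (\<Sum>m\<in>M. \<Sum>B | B \<in> Pow U \<and> B \<subseteq> S m. (x - 1) ^ card B)"
  proof (rule sum.cong[OF refl])
    fix m assume m: "m \<in> M"
    then have "{B. B \<in> Pow U \<and> B \<subseteq> S m} = Pow (S m)"
      using assms(3) by auto
    then show "x ^ card (S m) = (\<Sum>B | B \<in> Pow U \<and> B \<subseteq> S m. (x - 1) ^ card B)"
      using power_card_eq_sum_subsets[OF finite_subset[OF assms(3)[OF m] assms(2)]] by simp
  qed
  also have "\<dots> = (\<Sum>B\<in>Pow U. \<Sum>m | m \<in> M \<and> B \<subseteq> S m. (x - 1) ^ card B)"
    using assms by (intro sum.swap_restrict) auto
  finally show ?thesis by simp
qed

section \<open>Translation from mesh pattern occurrences to pairs\<close>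

lemma bottoms_subset:
  assumes "\<pi> permutes {1..n}"
  shows "asc_bottoms n \<pi> \<subseteq> {1..n}" "desc_bottoms n \<pi> \<subseteq> {1..n}"
proof -
  have "\<pi> p \<in> {1..n}" if "1 \<le> p" "p \<le> n" for p
    using permutes_in_image[OF assms, of p] that by simp
  then show "asc_bottoms n \<pi> \<subseteq> {1..n}" "desc_bottoms n \<pi> \<subseteq> {1..n}"
    unfolding asc_bottoms_def desc_bottoms_def asc_pair_def desc_pair_def by force+
qed

lemma grid_lines_pair: "a < b \<Longrightarrow> grid_lines n {a, b} = [0, a, b, n + 1]"
  by (simp add: grid_lines_def sorted_list_of_set_insert_remove)

text \<open>The values enter as the unordered set \<open>{lo, hi}\<close>, so that one equivalence
  serves both patterns. Between \<open>p\<close> and \<open>q\<close> the boxes (1,1) and (1,2)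
  leave only values below \<open>lo\<close>, as \<open>lo\<close> and \<open>hi\<close> are already
  taken.\<close>

lemma boxes_empty_iff_box_free:
  assumes "\<pi> permutes {1..n}" "1 \<le> p" "p < q" "q \<le> n"
    and v: "{\<pi> p, \<pi> q} = {lo, hi}" "lo < hi"
    and P: "P = [0, p, q, n + 1]" and V: "V = [0, lo, hi, n + 1]"
  shows "(\<forall>(i, j)\<in>shading. \<not> (\<exists>r\<in>{1..n}. P ! i < r \<and> r < P ! (i + 1) \<and> V ! j < \<pi> r \<and> \<pi> r < V ! (j + 1)))
    \<longleftrightarrow> box_free n \<pi> p q lo hi" (is "?L \<longleftrightarrow> ?R")
proof -
  have range: "1 \<le> \<pi> r" "\<pi> r \<le> n" if "1 \<le> r" "r \<le> n" for r
    using permutes_in_image[OF assms(1), of r] that by auto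
  have ne: "\<pi> r \<noteq> lo" "\<pi> r \<noteq> hi" if "r \<noteq> p" "r \<noteq> q" for r
    using that v permutes_inj[OF assms(1)] by (metis injD insertE insertI1 singletonD insert_commute)+
  have L: "?L \<longleftrightarrow> (\<forall>r. 1 \<le> r \<and> r \<le> n \<longrightarrow>
      \<not> (r < p \<and> lo < \<pi> r \<and> \<pi> r < hi) \<and> \<not> (p < r \<and> r < q \<and> lo < \<pi> r \<and> \<pi> r < hi) \<and>
      \<not> (p < r \<and> r < q \<and> hi < \<pi> r) \<and> \<not> (q < r \<and> \<pi> r < lo))"
  proof -
    have "?L \<longleftrightarrow> (\<forall>r\<in>{1..n}.
        \<not> (0 < r \<and> r < p \<and> lo < \<pi> r \<and> \<pi> r < hi) \<and> \<not> (p < r \<and> r < q \<and> lo < \<pi> r \<and> \<pi> r < hi) \<and>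
        \<not> (p < r \<and> r < q \<and> hi < \<pi> r \<and> \<pi> r < n + 1) \<and> \<not> (q < r \<and> r < n + 1 \<and> 0 < \<pi> r \<and> \<pi> r < lo))"
      unfolding P V shading_def
      by (simp add: numeral_2_eq_2 ball_conj_distrib, intro conj_cong ball_cong refl) auto
    also have "\<dots> \<longleftrightarrow> (\<forall>r\<in>{1..n}.
        \<not> (r < p \<and> lo < \<pi> r \<and> \<pi> r < hi) \<and> \<not> (p < r \<and> r < q \<and> lo < \<pi> r \<and> \<pi> r < hi) \<and>
        \<not> (p < r \<and> r < q \<and> hi < \<pi> r) \<and> \<not> (q < r \<and> \<pi> r < lo))"
    proof (rule ball_cong[OF refl])
      fix r assume "r \<in> {1..n}"
      then have "0 < r" "r < n + 1" "0 < \<pi> r" "\<pi> r < n + 1" using range[of r] by auto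
      then show "(\<not> (0 < r \<and> r < p \<and> lo < \<pi> r \<and> \<pi> r < hi) \<and>
          \<not> (p < r \<and> r < q \<and> lo < \<pi> r \<and> \<pi> r < hi) \<and>
          \<not> (p < r \<and> r < q \<and> hi < \<pi> r \<and> \<pi> r < n + 1) \<and>
          \<not> (q < r \<and> r < n + 1 \<and> 0 < \<pi> r \<and> \<pi> r < lo)) \<longleftrightarrow>
        (\<not> (r < p \<and> lo < \<pi> r \<and> \<pi> r < hi) \<and> \<not> (p < r \<and> r < q \<and> lo < \<pi> r \<and> \<pi> r < hi) \<and>
          \<not> (p < r \<and> r < q \<and> hi < \<pi> r) \<and> \<not> (q < r \<and> \<pi> r < lo))"
        by blast
    qed
    finally show ?thesis by (simp only: Ball_def atLeastAtMost_iff)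
  qed
  show ?thesis
  proof
    assume "?L"
    then have l: "\<not> (r < p \<and> lo < \<pi> r \<and> \<pi> r < hi)" "\<not> (p < r \<and> r < q \<and> lo < \<pi> r \<and> \<pi> r < hi)"
      "\<not> (p < r \<and> r < q \<and> hi < \<pi> r)" "\<not> (q < r \<and> \<pi> r < lo)" if "1 \<le> r" "r \<le> n" for r
      using that unfolding L by blast+
    show ?R
      unfolding box_free_def
    proof (intro conjI allI impI)
      fix r assume "1 \<le> r" "r < q" "r \<noteq> p"
      then show "\<pi> r \<le> lo \<or> hi \<le> \<pi> r" using l[of r] assms(2-4) by linarith
    next
      fix r assume "p < r" "r < q"
      then show "\<pi> r < lo" using l[of r] ne[of r] assms(2-4) by linarith
    next
      fix r assume "q < r" "r \<le> n"
      then show "lo \<le> \<pi> r" using l[of r] assms(2-4) by linarith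
    qed
  next
    assume R: ?R
    show ?L
      unfolding L
    proof (intro allI impI)
      fix r assume "1 \<le> r \<and> r \<le> n"
      then have "r < q \<longrightarrow> r \<noteq> p \<longrightarrow> \<pi> r \<le> lo \<or> hi \<le> \<pi> r" "p < r \<longrightarrow> r < q \<longrightarrow> \<pi> r < lo"
        "q < r \<longrightarrow> lo \<le> \<pi> r"
        using R unfolding box_free_def by blast+
      then show "\<not> (r < p \<and> lo < \<pi> r \<and> \<pi> r < hi) \<and> \<not> (p < r \<and> r < q \<and> lo < \<pi> r \<and> \<pi> r < hi) \<and>
          \<not> (p < r \<and> r < q \<and> hi < \<pi> r) \<and> \<not> (q < r \<and> \<pi> r < lo)"
        using assms(3) v(2) by linarith
    qed
  qed
qed

lemma is_occurrence_pair:
  assumes "\<pi> permutes {1..n}" "1 \<le> p" "p < q" "q \<le> n"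
  shows "is_occurrence pattern_12 n \<pi> {p, q} \<longleftrightarrow> asc_pair n \<pi> (\<pi> p) p q"
    and "is_occurrence pattern_21 n \<pi> {p, q} \<longleftrightarrow> desc_pair n \<pi> (\<pi> q) p q"
proof -
  have two: "{1..2::nat} = {1, 2}" by auto
  have "\<pi> p \<noteq> \<pi> q" using assms permutes_inj[OF assms(1)] by (metis injD less_irrefl)
  then consider "\<pi> p < \<pi> q" | "\<pi> q < \<pi> p" by linarith
  note c = this
  have P: "grid_lines n {p, q} = [0, p, q, n + 1]" using assms by (simp add: grid_lines_pair)
  have S: "{p, q} \<subseteq> {1..n}" "card {p, q} = 2" using assms by auto
  have asc: "grid_lines n (\<pi> ` {p, q}) = [0, \<pi> p, \<pi> q, n + 1]" if "\<pi> p < \<pi> q"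
    using that by (simp add: grid_lines_pair)
  have desc: "grid_lines n (\<pi> ` {p, q}) = [0, \<pi> q, \<pi> p, n + 1]" if "\<pi> q < \<pi> p"
    using grid_lines_pair[OF that] by (simp add: insert_commute)
  show "is_occurrence pattern_12 n \<pi> {p, q} \<longleftrightarrow> asc_pair n \<pi> (\<pi> p) p q"
    using c
  proof cases
    case 1
    show ?thesis
      unfolding pattern_12_def is_occurrence.simps Let_def asc_pair_def
        boxes_empty_iff_box_free[OF assms refl 1 P asc[OF 1]]
      using assms S 1 unfolding two by (simp add: P)
  next
    case 2
    \<comment> \<open>The two entries are in the wrong relative order, so both sides are
      false.\<close>
    then show ?thesis
      unfolding pattern_12_def is_occurrence.simps Let_def asc_pair_def two
      by (simp add: P Transposition.transpose_def)
  qed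
  show "is_occurrence pattern_21 n \<pi> {p, q} \<longleftrightarrow> desc_pair n \<pi> (\<pi> q) p q"
    using c
  proof cases
    case 2
    show ?thesis
      unfolding pattern_21_def is_occurrence.simps Let_def desc_pair_def
        boxes_empty_iff_box_free[OF assms insert_commute 2 P desc[OF 2]]
      using assms S 2 unfolding two by (simp add: P Transposition.transpose_def)
  next
    case 1
    then show ?thesis
      unfolding pattern_21_def is_occurrence.simps Let_def desc_pair_def two
      by (simp add: P Transposition.transpose_def)
  qed
qed

lemma is_occurrence_obtain_pair:
  assumes "is_occurrence (2, \<tau>, R) n \<pi> S"
  obtains p q where "S = {p, q}" "1 \<le> p" "p < q" "q \<le> n"
proof -
  have "card S = 2" "S \<subseteq> {1..n}" using assms by auto
  then obtain x y where "S = {x, y}" "x \<noteq> y" by (meson card_2_iff)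
  then show thesis
    using \<open>S \<subseteq> {1..n}\<close> that[of x y] that[of y x] by (cases x y rule: linorder_cases) auto
qed

text \<open>Position sets and smaller entries are both injective images of the same set of pairs
  \<open>(p, q)\<close>: the former because \<open>p < q\<close>, the latter by uniqueness of
  pairs.\<close>

lemma num_occurrences_eq_card_bottoms:
  assumes "\<pi> permutes {1..n}"
  shows "num_occurrences pattern_12 n \<pi> = card (asc_bottoms n \<pi>)"
    and "num_occurrences pattern_21 n \<pi> = card (desc_bottoms n \<pi>)"
proof -
  note inj = permutes_inj[OF assms]
  let ?A = "{(p, q). asc_pair n \<pi> (\<pi> p) p q}" and ?D = "{(p, q). desc_pair n \<pi> (\<pi> q) p q}"
  let ?set = "\<lambda>(p, q). {p, q}"
  have A: "1 \<le> p \<and> p < q \<and> q \<le> n" if "(p, q) \<in> ?A" for p q using that by (simp add: asc_pair_def)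
  have D: "1 \<le> p \<and> p < q \<and> q \<le> n" if "(p, q) \<in> ?D" for p q using that by (simp add: desc_pair_def)
  have inj_set: "inj_on ?set {(p, q). p < (q :: nat)}"
    by (auto simp: inj_on_def doubleton_eq_iff)
  have "{S. is_occurrence pattern_12 n \<pi> S} = ?set ` ?A"
  proof (intro equalityI subsetI)
    fix S assume "S \<in> {S. is_occurrence pattern_12 n \<pi> S}"
    then have S: "is_occurrence pattern_12 n \<pi> S" by simp
    then obtain p q where "S = {p, q}" "1 \<le> p" "p < q" "q \<le> n"
      unfolding pattern_12_def by (rule is_occurrence_obtain_pair)
    with S have "S = ?set (p, q)" "(p, q) \<in> ?A"
      using is_occurrence_pair(1)[OF assms, of p q] by simp_all
    then show "S \<in> ?set ` ?A" by (rule image_eqI)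
  next
    fix S assume "S \<in> ?set ` ?A"
    then obtain p q where "S = {p, q}" "(p, q) \<in> ?A" by auto
    then show "S \<in> {S. is_occurrence pattern_12 n \<pi> S}"
      using is_occurrence_pair(1)[OF assms, of p q] A[of p q] by simp
  qed
  moreover have "card (?set ` ?A) = card ?A"
    using A by (intro card_image inj_on_subset[OF inj_set]) auto
  moreover have "asc_bottoms n \<pi> = (\<lambda>(p, q). \<pi> p) ` ?A"
    by (force simp: asc_bottoms_def asc_pair_def)
  moreover have "card ((\<lambda>(p, q). \<pi> p) ` ?A) = card ?A"
    using asc_pair_unique[OF inj] by (intro card_image inj_onI) force
  ultimately show "num_occurrences pattern_12 n \<pi> = card (asc_bottoms n \<pi>)"
    by (simp add: num_occurrences_def)
  have "{S. is_occurrence pattern_21 n \<pi> S} = ?set ` ?D"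
  proof (intro equalityI subsetI)
    fix S assume "S \<in> {S. is_occurrence pattern_21 n \<pi> S}"
    then have S: "is_occurrence pattern_21 n \<pi> S" by simp
    then obtain p q where "S = {p, q}" "1 \<le> p" "p < q" "q \<le> n"
      unfolding pattern_21_def by (rule is_occurrence_obtain_pair)
    with S have "S = ?set (p, q)" "(p, q) \<in> ?D"
      using is_occurrence_pair(2)[OF assms, of p q] by simp_all
    then show "S \<in> ?set ` ?D" by (rule image_eqI)
  next
    fix S assume "S \<in> ?set ` ?D"
    then obtain p q where "S = {p, q}" "(p, q) \<in> ?D" by auto
    then show "S \<in> {S. is_occurrence pattern_21 n \<pi> S}"
      using is_occurrence_pair(2)[OF assms, of p q] D[of p q] by simp
  qed
  moreover have "card (?set ` ?D) = card ?D"
    using D by (intro card_image inj_on_subset[OF inj_set]) auto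
  moreover have "desc_bottoms n \<pi> = (\<lambda>(p, q). \<pi> q) ` ?D"
    by (force simp: desc_bottoms_def desc_pair_def)
  moreover have "card ((\<lambda>(p, q). \<pi> q) ` ?D) = card ?D"
    using desc_pair_unique[OF inj] by (intro card_image inj_onI) force
  ultimately show "num_occurrences pattern_21 n \<pi> = card (desc_bottoms n \<pi>)"
    by (simp add: num_occurrences_def)
qed

theorem theorem1:
  shows "equidistributed pattern_12 pattern_21"
proof -
  have "occurrence_poly pattern_12 n = occurrence_poly pattern_21 n" for n
  proof -
    let ?M = "{\<pi>. \<pi> permutes {1..n}}" and ?y = "monom 1 1 :: int poly"
    have fin: "finite ?M" by (rule finite_permutations) simp
    have "occurrence_poly pattern_12 n = (\<Sum>\<pi>\<in>?M. ?y ^ card (asc_bottoms n \<pi>))"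
      unfolding occurrence_poly_def
      by (intro sum.cong refl) (simp add: num_occurrences_eq_card_bottoms monom_power)
    also have "\<dots> = (\<Sum>B\<in>Pow {1..n}.
        of_nat (card {\<pi>\<in>?M. B \<subseteq> asc_bottoms n \<pi>}) * (?y - 1) ^ card B)"
      using bottoms_subset fin by (intro sum_power_card_eq_subsets) auto
    also have "\<dots> = (\<Sum>B\<in>Pow {1..n}.
        of_nat (card {\<pi>\<in>?M. B \<subseteq> desc_bottoms n \<pi>}) * (?y - 1) ^ card B)"
      \<comment> \<open>The two expansions in powers of \<open>?y - 1\<close> agree coefficient by
        coefficient, one for each \<open>B\<close>.\<close>
      using card_asc_bottoms_superset by (intro sum.cong refl) simp
    also have "\<dots> = (\<Sum>\<pi>\<in>?M. ?y ^ card (desc_bottoms n \<pi>))"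
      using bottoms_subset fin by (intro sum_power_card_eq_subsets[symmetric]) auto
    also have "\<dots> = occurrence_poly pattern_21 n"
      unfolding occurrence_poly_def
      by (intro sum.cong refl) (simp add: num_occurrences_eq_card_bottoms monom_power)
    finally show ?thesis .
  qed
  then show ?thesis by (simp add: equidistributed_def)
qed

end
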